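(* Let $\nu(x,y)$ be a smooth solution, on a domain of $\mathbb R^2=\mathbb C$, of the partial differential equation $$\Delta\ln\nu-2\nu=0\qquad(\Delta=\partial_x^2+\partial_y^2)$$ satisfying $\nu>0$ and $\nu_x\nu_y\neq0$. Then locally (in a neighborhood of every point) $\nu$ is given by the formula $$\nu=\frac{4(u_x^2+u_y^2)}{(u^2+v^2-1)^2},\qquad u^2+v^2-1\neq0,$$ where $w=u+iv$ is a holomorphic function of $x+iy$.
   Context: Subscripts $x,y$ denote partial derivatives. *)

theory Defs
  imports "HOL-Complex_Analysis.Complex_Analysis"
begin

text \<open>The plane is identified with \<^typ>\<open>complex\<close> via \<open>(x, y) = x + \<i> y\<close>; real functions of
  \<open>(x, y)\<close> are functions \<^typ>\<open>complex \<Rightarrow> real\<close>.\<close>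

definition pdx :: "(complex \<Rightarrow> real) \<Rightarrow> complex \<Rightarrow> real" where
  "pdx f z = deriv (\<lambda>x. f (Complex x (Im z))) (Re z)"

definition pdy :: "(complex \<Rightarrow> real) \<Rightarrow> complex \<Rightarrow> real" where
  "pdy f z = deriv (\<lambda>y. f (Complex (Re z) y)) (Im z)"

definition laplacian :: "(complex \<Rightarrow> real) \<Rightarrow> complex \<Rightarrow> real" where
  "laplacian f z = pdx (pdx f) z + pdy (pdy f) z"

text \<open>The following two notions are meant for open sets only. Since \<^const>\<open>deriv\<close> is total,
  existence of the partial derivatives is enforced by \<^const>\<open>differentiable_on\<close>, which asks for
  real (Frechet) differentiability.\<close>

primrec Ck_on :: "nat \<Rightarrow> (complex \<Rightarrow> real) \<Rightarrow> complex set \<Rightarrow> bool" where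
  "Ck_on 0 f S \<longleftrightarrow> continuous_on S f"
| "Ck_on (Suc k) f S \<longleftrightarrow> f differentiable_on S \<and> Ck_on k (pdx f) S \<and> Ck_on k (pdy f) S"

definition smooth_on :: "(complex \<Rightarrow> real) \<Rightarrow> complex set \<Rightarrow> bool" where
  "smooth_on f S \<longleftrightarrow> (\<forall>k. Ck_on k f S)"

end

theory Submission
  imports Defs
begin

text \<open>Put \<open>q = \<partial>\<^sub>z ln \<nu>\<close> and \<open>r = \<partial>\<^sub>z q\<close>. The equation says that \<open>q\<close> has \<open>z\<close>-conjugate derivative \<open>\<nu> / 2\<close>,
  and it follows that the Schwarzian \<open>r - q\<^sup>2 / 2\<close> is holomorphic. Hence \<open>g = 1 / sqrt \<nu>\<close> satisfies
  \<open>\<partial>\<^sub>z\<partial>\<^sub>z g = P g\<close> with \<open>P = - (r - q\<^sup>2 / 2) / 2\<close> holomorphic, together with the conjugate equation. So \<open>g\<close> is a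
  Hermitian form in the holomorphic solutions of \<open>h'' = P h\<close>; the equation fixes its determinant to be
  negative, so in a suitable basis with Wronskian \<open>1 / 2\<close> it reads \<open>g = |k|\<^sup>2 - |l|\<^sup>2\<close>. Then
  \<open>w = l / k\<close> has \<open>w' = 1 / (2 k\<^sup>2)\<close>, and \<open>\<nu> = 1 / g\<^sup>2\<close> is the asserted formula.\<close>

section \<open>Second-order linear holomorphic differential equations\<close>

text \<open>Comparing coefficients determines \<open>H\<close> recursively. A geometric bound on
  \<open>S\<close> passes to \<open>H\<close>, because the \<open>m + 1\<close> terms of the
  convolution are outweighed by the factor \<open>(m + 2) * (m + 1)\<close> produced by two
  derivatives.\<close>

lemma fps_linear_ODE2:
  fixes S :: "complex fps"
  assumes "fps_conv_radius S > 0"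
  obtains H where "fps_nth H 0 = a" "fps_nth H 1 = b" "fps_deriv (fps_deriv H) = S * H"
    "fps_conv_radius H > 0"
proof -
  \<comment> \<open>A coefficient depends on all those up to index \<open>n - 2\<close>, hence the
    well-founded recursion. \<open>step\<close> consults smaller indices only, which is the
    admissibility needed to unfold it.\<close>
  define step where "step h n = (if n = 0 then a else if n = 1 then b else
    (\<Sum>i\<le>n-2. fps_nth S i * h (n - 2 - i)) / of_nat (n * (n - 1)))" for h :: "nat \<Rightarrow> complex" and n
  define c where "c = wfrec less_than (\<lambda>h n. step h n)"
  have c: "c n = step c n" for n
  proof -
    have "adm_wf less_than step"
      unfolding adm_wf_def step_def by (auto intro!: sum.cong)
    then show ?thesis
      unfolding c_def by (subst wfrec_fixpoint) auto
  qed
  have c0: "c 0 = a" and c1: "c (Suc 0) = b"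
    by (subst c, simp add: step_def)+
  have c2: "of_nat (n + 2) * of_nat (n + 1) * c (n + 2) = (\<Sum>i\<le>n. fps_nth S i * c (n - i))" for n
  proof -
    have "c (n + 2) = (\<Sum>i\<le>n. fps_nth S i * c (n - i)) / of_nat ((n + 2) * (n + 1))"
      by (subst c) (simp add: step_def)
    moreover have "of_nat ((n + 2) * (n + 1)) \<noteq> (0 :: complex)"
      by (simp only: of_nat_eq_0_iff) simp
    ultimately show ?thesis
      by (simp add: field_simps del: of_nat_add of_nat_mult of_nat_Suc flip: of_nat_mult)
  qed
  \<comment> \<open>Bounded terms at a single nonzero point of the disc of convergence give a
    geometric bound on the coefficients of \<open>S\<close>.\<close>
  obtain z :: complex where z: "z \<noteq> 0" "ereal (norm z) < fps_conv_radius S"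
  proof -
    obtain r :: real where "0 < ereal r" "ereal r < fps_conv_radius S"
      using ereal_dense2[OF assms] by blast
    then show ?thesis using that[of "of_real r"] by auto
  qed
  have "Bseq (\<lambda>n. fps_nth S n * z ^ n)"
    using summable_fps[OF z(2)] by (simp add: convergent_imp_Bseq summable_imp_convergent summable_LIMSEQ_zero convergentI)
  then obtain M where M: "M > 0" "\<And>n. norm (fps_nth S n * z ^ n) \<le> M"
    by (auto elim!: BseqE)
  \<comment> \<open>\<open>inverse (norm z) \<le> R\<close> serves the bound on \<open>S\<close>;
    \<open>1 \<le> R\<close> and \<open>M \<le> R\<close> give \<open>M \<le> R\<^sup>2\<close>, so
    the constant \<open>M\<close> is absorbed by the index shift of 2 in the induction.\<close>
  define R where "R = max (inverse (norm z)) (max 1 M)"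
  have R: "R \<ge> 1" "R \<ge> M" "inverse (norm z) \<le> R"
    by (auto simp: R_def)
  have s: "norm (fps_nth S n) \<le> M * R ^ n" for n
  proof -
    have "norm (fps_nth S n) = norm (fps_nth S n * z ^ n) * inverse (norm z) ^ n"
      using z(1) by (simp add: norm_mult norm_power power_mult_distrib[symmetric] mult.assoc)
    also have "\<dots> \<le> M * R ^ n"
      by (intro mult_mono M power_mono R) (use M(1) in auto)
    finally show ?thesis .
  qed
  define K where "K = max (norm a) (norm b)"
  have K: "norm a \<le> K" "norm b \<le> K" "K \<ge> 0"
    by (auto simp: K_def le_max_iff_disj)
  have bound: "norm (c n) \<le> K * R ^ n" for n
  proof (induction n rule: less_induct)
    case (less n)
    consider "n = 0" | "n = 1" | m where "n = m + 2"
      by (metis One_nat_def Suc_1 add.commute add_2_eq_Suc not0_implies_Suc)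
    then show ?case
    proof cases
      case 1 then show ?thesis using c0 K by simp
    next
      case 2
      have "K * 1 \<le> K * R" by (intro mult_left_mono R K)
      then show ?thesis using 2 c1 K by simp
    next
      case 3
      have "norm (\<Sum>i\<le>m. fps_nth S i * c (m - i)) \<le> (\<Sum>i\<le>m. M * R ^ i * (K * R ^ (m - i)))"
        unfolding norm_mult[symmetric]
        by (rule order_trans[OF norm_sum], rule sum_mono, subst norm_mult, rule mult_mono)
           (use s less 3 M R in auto)
      also have "\<dots> = (\<Sum>i\<le>m. M * K * R ^ m)"
        by (intro sum.cong refl) (simp add: mult.assoc mult.left_commute flip: power_add)
      also have "\<dots> = real (m + 1) * (M * (K * R ^ m))"
        by simp
      also have "\<dots> \<le> real (m + 1) * (R\<^sup>2 * (K * R ^ m))"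
        using R K M(1) self_le_power[of R 2]
        by (intro mult_left_mono mult_right_mono) auto
      also have "\<dots> = real (m + 1) * (K * R ^ n)"
        using 3 by (simp add: power_add power2_eq_square)
      finally have "norm (of_nat (m + 2) * of_nat (m + 1) * c n) \<le> real (m + 1) * (K * R ^ n)"
        using c2[of m] 3 by simp
      then have "real (m + 1) * (real (m + 2) * norm (c n)) \<le> real (m + 1) * (K * R ^ n)"
        by (simp only: norm_mult norm_of_nat mult_ac)
      then have "real (m + 2) * norm (c n) \<le> K * R ^ n"
        by (subst (asm) mult_le_cancel_left_pos) auto
      moreover have "1 * norm (c n) \<le> real (m + 2) * norm (c n)"
        by (intro mult_right_mono) auto
      ultimately show ?thesis by simp
    qed
  qed
  \<comment> \<open>At distance \<open>1 / (2 * R)\<close> the bound becomes a geometric series of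
    ratio 1/2.\<close>
  have "summable (\<lambda>n. c n * of_real (1 / (2 * R)) ^ n)"
  proof (rule summable_comparison_test')
    show "summable (\<lambda>n. K * (1 / 2) ^ n)"
      by (intro summable_mult) (simp add: summable_geometric)
    show "norm (c n * of_real (1 / (2 * R)) ^ n) \<le> K * (1 / 2) ^ n" for n
      using mult_right_mono[OF bound[of n], of "(1 / (2 * R)) ^ n"] R
      by (simp add: norm_mult norm_power norm_divide power_divide power_mult_distrib)
  qed
  then have le: "ereal (norm (of_real (1 / (2 * R)) :: complex)) \<le> fps_conv_radius (Abs_fps c)"
    unfolding fps_conv_radius_def by (intro conv_radius_geI) simp
  have "R \<noteq> 0" using R(1) by linarith
  then have "0 < norm (of_real (1 / (2 * R)) :: complex)" by simp
  then have "0 < ereal (norm (of_real (1 / (2 * R)) :: complex))"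
    by (simp only: zero_ereal_def less_ereal.simps)
  then have "fps_conv_radius (Abs_fps c) > 0"
    using le by (rule less_le_trans)
  moreover have "fps_deriv (fps_deriv (Abs_fps c)) = S * Abs_fps c"
    by (rule fps_ext) (use c2 in \<open>simp add: fps_mult_nth atLeast0AtMost algebra_simps\<close>)
  ultimately show ?thesis
    using that[of "Abs_fps c"] c0 c1 by simp
qed

text \<open>The formal solution built from the Taylor series of \<open>P\<close> at \<open>p\<close>
  is summed on a ball inside its disc of convergence. The radius obtained may depend on
  \<open>a\<close> and \<open>b\<close>.\<close>

lemma holomorphic_linear_ODE2:
  assumes P: "P holomorphic_on ball p r" and "r > 0"
  obtains h \<rho> where "0 < \<rho>" "\<rho> \<le> r" "h holomorphic_on ball p \<rho>" "h p = a" "deriv h p = b"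
    "\<And>z. z \<in> ball p \<rho> \<Longrightarrow> deriv (deriv h) z = P z * h z"
proof -
  define S where "S = fps_expansion P p"
  have P': "P holomorphic_on eball p (ereal r)" using P by simp
  have rS: "fps_conv_radius S \<ge> r"
    unfolding S_def by (rule conv_radius_fps_expansion[OF P'])
  then have "fps_conv_radius S > 0"
    using \<open>r > 0\<close> by (simp add: zero_ereal_def ereal_le_less)
  then obtain H where H: "fps_nth H 0 = a" "fps_nth H 1 = b" "fps_deriv (fps_deriv H) = S * H"
    "fps_conv_radius H > 0"
    by (rule fps_linear_ODE2)
  obtain t where t: "0 < t" "ereal t < fps_conv_radius H"
    using ereal_dense2[OF H(4)] by auto
  define \<rho> where "\<rho> = min t r"
  have \<rho>: "0 < \<rho>" "\<rho> \<le> r" "\<rho> \<le> t"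
    using t \<open>r > 0\<close> by (auto simp: \<rho>_def)
  have rad: "ereal (norm (z - p)) < fps_conv_radius H" "ereal (norm (z - p)) < fps_conv_radius (fps_deriv H)"
    "ereal (norm (z - p)) < fps_conv_radius S" if "z \<in> ball p \<rho>" for z
  proof -
    have "norm (z - p) < t" "norm (z - p) < r"
      using that \<rho> by (auto simp: dist_norm norm_minus_commute)
    then show "ereal (norm (z - p)) < fps_conv_radius H" "ereal (norm (z - p)) < fps_conv_radius S"
      using t(2) rS by (metis less_ereal.simps(1) order.strict_trans, metis less_ereal.simps(1) less_le_trans)
    then show "ereal (norm (z - p)) < fps_conv_radius (fps_deriv H)"
      using fps_conv_radius_deriv[of H] by (meson less_le_trans)
  qed
  define h where "h z = eval_fps H (z - p)" for z
  define h1 where "h1 z = eval_fps (fps_deriv H) (z - p)" for z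
  have d: "(h has_field_derivative h1 z) (at z)" if "z \<in> ball p \<rho>" for z
    unfolding h_def h1_def using rad[OF that]
    by (auto intro!: derivative_eq_intros DERIV_chain2[of "eval_fps H"] has_field_derivative_eval_fps)
  have d1: "(h1 has_field_derivative P z * h z) (at z)" if "z \<in> ball p \<rho>" for z
  proof -
    have "(h1 has_field_derivative eval_fps (fps_deriv (fps_deriv H)) (z - p)) (at z)"
      unfolding h1_def using rad[OF that]
      by (auto intro!: derivative_eq_intros DERIV_chain2[of "eval_fps (fps_deriv H)"] has_field_derivative_eval_fps)
    moreover have "eval_fps S (z - p) = P z"
      unfolding S_def by (rule eval_fps_expansion[OF P']) (use that \<rho> in auto)
    ultimately show ?thesis
      using rad[OF that] H(3) by (simp add: eval_fps_mult h_def)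
  qed
  have dh: "deriv h z = h1 z" if "z \<in> ball p \<rho>" for z
    using d[OF that] by (rule DERIV_imp_deriv)
  show ?thesis
  proof
    show "h holomorphic_on ball p \<rho>"
      unfolding holomorphic_on_open[OF open_ball] using d by blast
    show "h p = a" using H(1) by (simp add: h_def eval_fps_at_0)
    show "deriv h p = b" using H(2) \<rho> dh[of p] by (simp add: h1_def eval_fps_at_0)
    show "deriv (deriv h) z = P z * h z" if "z \<in> ball p \<rho>" for z
    proof -
      \<comment> \<open>\<open>deriv h\<close> is known to equal \<open>h1\<close> only on the ball,
        so the derivative is transferred along an open set.\<close>
      have "(deriv h has_field_derivative P z * h z) (at z)"
        by (rule has_field_derivative_transform_within_open[OF d1[OF that] open_ball that]) (simp add: dh)
      then show ?thesis by (rule DERIV_imp_deriv)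
    qed
  qed (use \<rho> in auto)
qed

section \<open>Partial derivatives\<close>

text \<open>The mean value theorem in \<open>x\<close> for \<open>g x (b+t) - g x b\<close>, then in
  \<open>y\<close> for \<open>gx x\<close>. The second difference is symmetric in the two variables,
  so it can be compared with both mixed partials.\<close>

lemma second_difference_mvt:
  fixes g gx gxy :: "real \<Rightarrow> real \<Rightarrow> real"
  assumes "t > 0"
    and gx: "\<And>x y. x \<in> {a..a+t} \<Longrightarrow> y \<in> {b..b+t} \<Longrightarrow> ((\<lambda>x. g x y) has_real_derivative gx x y) (at x)"
    and gxy: "\<And>x y. x \<in> {a..a+t} \<Longrightarrow> y \<in> {b..b+t} \<Longrightarrow> (gx x has_real_derivative gxy x y) (at y)"
  shows "\<exists>x\<in>{a..a+t}. \<exists>y\<in>{b..b+t}. g (a+t) (b+t) - g (a+t) b - g a (b+t) + g a b = t * t * gxy x y"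
proof -
  have "\<exists>x>a. x < a + t \<and> (g (a+t) (b+t) - g (a+t) b) - (g a (b+t) - g a b) = (a + t - a) * (gx x (b+t) - gx x b)"
    using \<open>t > 0\<close> by (intro MVT2) (auto intro!: DERIV_diff gx)
  then obtain x where x: "x > a" "x < a + t"
    "(g (a+t) (b+t) - g (a+t) b) - (g a (b+t) - g a b) = t * (gx x (b+t) - gx x b)" by auto
  have "\<exists>y>b. y < b + t \<and> gx x (b+t) - gx x b = (b + t - b) * gxy x y"
    using \<open>t > 0\<close> x by (intro MVT2) (auto intro!: gxy)
  then obtain y where "y > b" "y < b + t" "gx x (b+t) - gx x b = t * gxy x y" by auto
  with x show ?thesis
    by (intro bexI[of _ x] bexI[of _ y]) (auto simp: algebra_simps)
qed

lemma has_derivative_complex_slices: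
  assumes "(f has_derivative f') (at z)"
  shows "((\<lambda>x. f (Complex x (Im z))) has_real_derivative f' 1) (at (Re z))"
    and "((\<lambda>y. f (Complex (Re z) y)) has_real_derivative f' \<i>) (at (Im z))"
proof -
  interpret f': bounded_linear f' using assms by (rule has_derivative_bounded_linear)
  have 1: "((\<lambda>x. Complex x (Im z)) has_derivative (\<lambda>h. h *\<^sub>R 1)) (at (Re z))"
    unfolding Complex_eq by (auto intro!: derivative_eq_intros simp: scaleR_conv_of_real)
  have 2: "((\<lambda>y. Complex (Re z) y) has_derivative (\<lambda>h. h *\<^sub>R \<i>)) (at (Im z))"
    unfolding Complex_eq by (auto intro!: derivative_eq_intros simp: scaleR_conv_of_real)
  show "((\<lambda>x. f (Complex x (Im z))) has_real_derivative f' 1) (at (Re z))"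
    using has_derivative_compose[OF 1, of f f'] assms
    by (simp add: has_field_derivative_def f'.scaleR mult_commute_abs)
  show "((\<lambda>y. f (Complex (Re z) y)) has_real_derivative f' \<i>) (at (Im z))"
    using has_derivative_compose[OF 2, of f f'] assms
    by (simp add: has_field_derivative_def f'.scaleR mult_commute_abs)
qed

lemma pdx_eqI: "(f has_derivative f') (at z) \<Longrightarrow> pdx f z = f' 1"
  and pdy_eqI: "(f has_derivative f') (at z) \<Longrightarrow> pdy f z = f' \<i>"
  unfolding pdx_def pdy_def by (auto intro!: DERIV_imp_deriv has_derivative_complex_slices)

text \<open>A real-linear differential is determined by its values at 1 and \<open>\<i>\<close>,
  which are the two slice derivatives.\<close>

lemma differentiable_on_has_derivative_pd:
  assumes "f differentiable_on S" "open S" "z \<in> S"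
  shows "(f has_derivative (\<lambda>h. pdx f z * Re h + pdy f z * Im h)) (at z)"
proof -
  obtain f' where f': "(f has_derivative f') (at z)"
    using assms by (metis at_within_open differentiable_def differentiable_on_def)
  interpret f': bounded_linear f' using f' by (rule has_derivative_bounded_linear)
  have "f' h = pdx f z * Re h + pdy f z * Im h" for h
  proof -
    have "h = Re h *\<^sub>R 1 + Im h *\<^sub>R \<i>" by (simp add: complex_eq_iff)
    then have "f' h = f' (Re h *\<^sub>R 1 + Im h *\<^sub>R \<i>)" by simp
    then show ?thesis
      by (simp only: f'.add f'.scaleR pdx_eqI[OF f'] pdy_eqI[OF f']) (simp add: mult.commute)
  qed
  then have "f' = (\<lambda>h. pdx f z * Re h + pdy f z * Im h)" by blast
  with f' show ?thesis by simp
qed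

text \<open>Schwarz's theorem: the second difference over a small square is \<open>t * t\<close>
  times either mixed partial at some point of the square. By continuity both values lie within half
  the supposed gap of those at \<open>z\<close>.\<close>

lemma pdy_pdx_commute:
  assumes "open S" "Ck_on 2 f S" "z \<in> S"
  shows "pdy (pdx f) z = pdx (pdy f) z"
proof (rule ccontr)
  assume ne: "pdy (pdx f) z \<noteq> pdx (pdy f) z"
  define e where "e = dist (pdy (pdx f) z) (pdx (pdy f) z) / 2"
  have e: "e > 0" using ne by (simp add: e_def)
  have C: "f differentiable_on S" "pdx f differentiable_on S" "pdy f differentiable_on S"
    "continuous_on S (pdy (pdx f))" "continuous_on S (pdx (pdy f))"
    using assms(2) by (auto simp: numeral_2_eq_2)
  have "\<forall>\<^sub>F w in nhds z. w \<in> S"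
    using assms by (simp add: eventually_nhds_in_open)
  moreover have "\<forall>\<^sub>F w in nhds z. dist (pdy (pdx f) w) (pdy (pdx f) z) < e"
    by (rule tendstoD[OF _ e]) (use C assms in \<open>simp add: continuous_on_eq_continuous_at isCont_def tendsto_at_iff_tendsto_nhds\<close>)
  moreover have "\<forall>\<^sub>F w in nhds z. dist (pdx (pdy f) w) (pdx (pdy f) z) < e"
    by (rule tendstoD[OF _ e]) (use C assms in \<open>simp add: continuous_on_eq_continuous_at isCont_def tendsto_at_iff_tendsto_nhds\<close>)
  ultimately have "\<forall>\<^sub>F w in nhds z. w \<in> S \<and> dist (pdy (pdx f) w) (pdy (pdx f) z) < e \<and>
     dist (pdx (pdy f) w) (pdx (pdy f) z) < e"
    by eventually_elim simp
  then obtain d where d: "d > 0" "\<And>w. dist w z < d \<Longrightarrow> w \<in> S \<and> dist (pdy (pdx f) w) (pdy (pdx f) z) < e \<and>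
     dist (pdx (pdy f) w) (pdx (pdy f) z) < e"
    by (auto simp: eventually_nhds_metric)
  \<comment> \<open>With this side length, coordinate distances in the square add up to at most
    \<open>2 * d / 3 < d\<close>.\<close>
  define t where "t = d / 3"
  have t: "t > 0" using d by (simp add: t_def)
  let ?a = "Re z" and ?b = "Im z"
  have near: "dist (Complex x y) z < d" if "x \<in> {?a..?a+t}" "y \<in> {?b..?b+t}" for x y
  proof -
    have "dist (Complex x y) z \<le> \<bar>x - ?a\<bar> + \<bar>y - ?b\<bar>"
      using cmod_le[of "Complex x y - z"] by (simp add: dist_norm)
    also have "\<dots> < d" using that t by (auto simp: t_def)
    finally show ?thesis .
  qed
  have slice: "((\<lambda>x. g (Complex x y)) has_real_derivative pdx g (Complex x y)) (at x)"
    "((\<lambda>y. g (Complex x y)) has_real_derivative pdy g (Complex x y)) (at y)"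
    if "x \<in> {?a..?a+t}" "y \<in> {?b..?b+t}" "g differentiable_on S" for x y g
    using has_derivative_complex_slices[OF differentiable_on_has_derivative_pd[OF that(3) assms(1)], of "Complex x y"]
      d(2)[OF near[OF that(1,2)]] by simp_all
  obtain x y where 1: "x \<in> {?a..?a+t}" "y \<in> {?b..?b+t}"
    "f (Complex (?a+t) (?b+t)) - f (Complex (?a+t) ?b) - f (Complex ?a (?b+t)) + f (Complex ?a ?b)
      = t * t * pdy (pdx f) (Complex x y)"
    using second_difference_mvt[of t ?a ?b "\<lambda>x y. f (Complex x y)" "\<lambda>x y. pdx f (Complex x y)"
       "\<lambda>x y. pdy (pdx f) (Complex x y)"] slice C t by blast
  obtain y' x' where 2: "x' \<in> {?a..?a+t}" "y' \<in> {?b..?b+t}"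
    "f (Complex (?a+t) (?b+t)) - f (Complex ?a (?b+t)) - f (Complex (?a+t) ?b) + f (Complex ?a ?b)
      = t * t * pdx (pdy f) (Complex x' y')"
    using second_difference_mvt[of t ?b ?a "\<lambda>y x. f (Complex x y)" "\<lambda>y x. pdy f (Complex x y)"
       "\<lambda>y x. pdx (pdy f) (Complex x y)"] slice C t by blast
  have "t * t * pdy (pdx f) (Complex x y) = t * t * pdx (pdy f) (Complex x' y')"
    using 1(3) 2(3) by linarith
  then have "pdy (pdx f) (Complex x y) = pdx (pdy f) (Complex x' y')"
    using t by simp
  then have "dist (pdy (pdx f) z) (pdx (pdy f) z) < e + e"
    using d(2)[OF near[OF 1(1,2)]] d(2)[OF near[OF 2(1,2)]]
    by (metis dist_commute dist_triangle_less_add)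
  then show False by (simp add: e_def)
qed

lemma pd_transform:
  assumes "(f has_derivative f') (at z)" "open S" "z \<in> S" "\<And>w. w \<in> S \<Longrightarrow> f w = g w"
  shows "pdx g z = f' 1" "pdy g z = f' \<i>"
proof -
  have "(g has_derivative f') (at z)"
    using assms by (rule has_derivative_transform_within_open)
  then show "pdx g z = f' 1" "pdy g z = f' \<i>"
    by (rule pdx_eqI, rule pdy_eqI)
qed

lemma pd_cong:
  assumes "f differentiable_on S" "open S" "z \<in> S" "\<And>w. w \<in> S \<Longrightarrow> f w = g w"
  shows "pdx f z = pdx g z" "pdy f z = pdy g z"
  using pd_transform[OF differentiable_on_has_derivative_pd[OF assms(1-3)] assms(2-4)] by simp_all

lemma laplacian_ln:
  assumes S: "open S" and f: "Ck_on 2 f S" "\<And>z. z \<in> S \<Longrightarrow> f z > 0" and z: "z \<in> S"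
  shows "laplacian (\<lambda>\<zeta>. ln (f \<zeta>)) z =
    (pdx (pdx f) z + pdy (pdy f) z) / f z - ((pdx f z)\<^sup>2 + (pdy f z)\<^sup>2) / (f z)\<^sup>2"
proof -
  have C: "f differentiable_on S" "pdx f differentiable_on S" "pdy f differentiable_on S"
    using f(1) by (auto simp: numeral_2_eq_2)
  note d = differentiable_on_has_derivative_pd[OF _ S]
  have ln: "((\<lambda>\<zeta>. ln (f \<zeta>)) has_derivative (\<lambda>h. (pdx f w * Re h + pdy f w * Im h) / f w)) (at w)" if "w \<in> S" for w
    using f(2)[OF that] by (auto intro!: derivative_eq_intros d[OF C(1) that] simp: divide_inverse mult.commute)
  have quot: "((\<lambda>w. g w / f w) has_derivative
      (\<lambda>h. (pdx g z * Re h + pdy g z * Im h) / f z - g z * (pdx f z * Re h + pdy f z * Im h) / (f z)\<^sup>2)) (at z)"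
    if "g differentiable_on S" for g
    by (rule has_derivative_eq_rhs, rule has_derivative_divide'[OF d[OF that z] d[OF C(1) z]])
       (use f(2)[OF z] in \<open>auto simp: fun_eq_iff field_simps power2_eq_square\<close>)
  have "pdx (pdx (\<lambda>\<zeta>. ln (f \<zeta>))) z = pdx (pdx f) z / f z - pdx f z * pdx f z / (f z)\<^sup>2"
    by (subst pd_transform(1)[OF quot[OF C(2)] S z]) (simp_all add: pdx_eqI[OF ln])
  moreover have "pdy (pdy (\<lambda>\<zeta>. ln (f \<zeta>))) z = pdy (pdy f) z / f z - pdy f z * pdy f z / (f z)\<^sup>2"
    by (subst pd_transform(2)[OF quot[OF C(3)] S z]) (simp_all add: pdy_eqI[OF ln])
  ultimately show ?thesis
    by (simp add: laplacian_def power2_eq_square add_divide_distrib)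
qed

text \<open>By the Cauchy-Riemann equations the differential of \<open>Re w\<close> is
  \<open>Re (w' * h)\<close>, so its partials are \<open>Re w'\<close> and
  \<open>- Im w'\<close>.\<close>

lemma gradient_Re_holomorphic:
  assumes "(w has_field_derivative w') (at z)"
  shows "(pdx (\<lambda>z. Re (w z)) z)\<^sup>2 + (pdy (\<lambda>z. Re (w z)) z)\<^sup>2 = (norm w')\<^sup>2"
proof -
  have "((\<lambda>z. Re (w z)) has_derivative (\<lambda>h. Re (w' * h))) (at z)"
    using assms unfolding has_field_derivative_def by (rule has_derivative_Re)
  from pdx_eqI[OF this] pdy_eqI[OF this] show ?thesis
    by (simp add: cmod_power2)
qed

section \<open>Wirtinger derivatives\<close>

text \<open>\<open>a\<close> and \<open>b\<close> are the derivatives of \<open>F\<close> in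
  \<open>z\<close> and in its conjugate. Stating both through one real differential includes
  differentiability and lets the calculus rules come from those for
  \<open>has_derivative\<close>.\<close>

definition has_wirtinger :: "(complex \<Rightarrow> complex) \<Rightarrow> complex \<Rightarrow> complex \<Rightarrow> complex \<Rightarrow> bool" where
  "has_wirtinger F a b z \<longleftrightarrow> (F has_derivative (\<lambda>h. a * h + b * cnj h)) (at z)"

text \<open>Applied first, it lets the calculus rules compute the derivatives and leaves two
  algebraic identities.\<close>

lemma has_wirtinger_eq: "has_wirtinger F a b z \<Longrightarrow> a = a' \<Longrightarrow> b = b' \<Longrightarrow> has_wirtinger F a' b' z"
  by simp

lemma has_wirtinger_const: "has_wirtinger (\<lambda>_. c) 0 0 z"
  by (simp add: has_wirtinger_def)

lemma has_wirtinger_add: "has_wirtinger F a b z \<Longrightarrow> has_wirtinger G c d z \<Longrightarrow>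
    has_wirtinger (\<lambda>z. F z + G z) (a + c) (b + d) z"
  unfolding has_wirtinger_def by (drule (1) has_derivative_add) (simp add: algebra_simps)

lemma has_wirtinger_diff: "has_wirtinger F a b z \<Longrightarrow> has_wirtinger G c d z \<Longrightarrow>
    has_wirtinger (\<lambda>z. F z - G z) (a - c) (b - d) z"
  unfolding has_wirtinger_def by (drule (1) has_derivative_diff) (simp add: algebra_simps)

lemma has_wirtinger_mult: "has_wirtinger F a b z \<Longrightarrow> has_wirtinger G c d z \<Longrightarrow>
    has_wirtinger (\<lambda>z. F z * G z) (a * G z + F z * c) (b * G z + F z * d) z"
  unfolding has_wirtinger_def by (drule (1) has_derivative_mult) (simp add: algebra_simps)

lemma has_wirtinger_cnj: "has_wirtinger F a b z \<Longrightarrow> has_wirtinger (\<lambda>z. cnj (F z)) (cnj b) (cnj a) z"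
  unfolding has_wirtinger_def by (drule has_derivative_cnj) (simp add: add.commute)

lemma has_wirtinger_compose_field:
  "has_wirtinger F a b z \<Longrightarrow> (G has_field_derivative c) (at (F z)) \<Longrightarrow>
    has_wirtinger (\<lambda>z. G (F z)) (c * a) (c * b) z"
  unfolding has_wirtinger_def has_field_derivative_def
  by (drule (1) has_derivative_compose) (simp add: algebra_simps)

lemma has_wirtinger_field: "(F has_field_derivative c) (at z) \<Longrightarrow> has_wirtinger F c 0 z"
  by (simp add: has_wirtinger_def has_field_derivative_def)

lemma has_wirtinger_cmult: "has_wirtinger F a b z \<Longrightarrow> has_wirtinger (\<lambda>z. k * F z) (k * a) (k * b) z"
  using has_wirtinger_mult[OF has_wirtinger_const[of k z]] by simp

lemma has_wirtinger_inverse: "has_wirtinger F a b z \<Longrightarrow> F z \<noteq> 0 \<Longrightarrow>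
    has_wirtinger (\<lambda>z. inverse (F z)) (- a / (F z)\<^sup>2) (- b / (F z)\<^sup>2) z"
  by (rule has_wirtinger_eq[OF has_wirtinger_compose_field[where G = inverse]])
     (auto intro!: derivative_eq_intros simp: power2_eq_square divide_simps)

text \<open>A vanishing conjugate derivative is the Cauchy-Riemann condition.\<close>

lemma has_wirtinger_imp_field: "has_wirtinger F c 0 z \<Longrightarrow> (F has_field_derivative c) (at z)"
  by (simp add: has_wirtinger_def has_field_derivative_def)

lemma has_wirtinger_transform:
  assumes "has_wirtinger F a b z" "open S" "z \<in> S" "\<And>w. w \<in> S \<Longrightarrow> F w = G w"
  shows "has_wirtinger G a b z"
  using assms unfolding has_wirtinger_def by (blast intro: has_derivative_transform_within_open)

lemma has_wirtinger_of_real: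
  assumes "f differentiable_on S" "open S" "z \<in> S"
  shows "has_wirtinger (\<lambda>z. of_real (f z)) (Complex (pdx f z) (- pdy f z) / 2) (Complex (pdx f z) (pdy f z) / 2) z"
proof -
  have "((\<lambda>z. of_real (f z)) has_derivative (\<lambda>h. of_real (pdx f z * Re h + pdy f z * Im h) :: complex)) (at z)"
    by (rule has_derivative_of_real[OF differentiable_on_has_derivative_pd[OF assms]])
  then show ?thesis
    unfolding has_wirtinger_def
    by (rule has_derivative_eq_rhs) (auto simp: fun_eq_iff complex_eq_iff field_simps)
qed

text \<open>Evaluating the differential at 1 and at \<open>\<i>\<close> recovers
  \<open>a + b\<close> and \<open>a - b\<close>.\<close>

lemma has_wirtinger_unique:
  assumes "has_wirtinger F a b z" "has_wirtinger F a' b' z"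
  shows "a = a'" "b = b'"
proof -
  have "(\<lambda>h. a * h + b * cnj h) = (\<lambda>h. a' * h + b' * cnj h)"
    using assms unfolding has_wirtinger_def by (rule has_derivative_unique)
  then have "a * h + b * cnj h = a' * h + b' * cnj h" for h by meson
  from this[of 1] this[of \<i>] have 1: "a + b = a' + b'" and "\<i> * (a - b) = \<i> * (a' - b')"
    by (simp_all add: algebra_simps)
  then have "a - b = a' - b'" by simp
  with 1 have "(a + b) + (a - b) = (a' + b') + (a' - b')" by simp
  then show "a = a'" by simp
  with 1 show "b = b'" by simp
qed

section \<open>The Liouville equation\<close>

text \<open>Uniqueness for a function whose second derivatives in \<open>z\<close> and in the
  conjugate are \<open>P\<close> and \<open>cnj P\<close> times itself: pairing it with solutions of
  \<open>h'' = P h\<close> in each variable gives constants, which are zero at \<open>p\<close>.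
  Independent solutions \<open>k\<close>, \<open>l\<close> then recover \<open>d\<close>.\<close>

lemma has_wirtinger_zero_system:
  assumes U: "open U" "connected U" "p \<in> U"
    and d: "\<And>z. z \<in> U \<Longrightarrow> has_wirtinger d (d1 z) (d2 z) z"
      "\<And>z. z \<in> U \<Longrightarrow> has_wirtinger d1 (P z * d z) (d12 z) z"
      "\<And>z. z \<in> U \<Longrightarrow> has_wirtinger d2 (d12 z) (cnj (P z) * d z) z"
      "\<And>z. z \<in> U \<Longrightarrow> has_wirtinger d12 (P z * d2 z) (cnj (P z) * d1 z) z"
    and zero: "d p = 0" "d1 p = 0" "d2 p = 0" "d12 p = 0"
    and k: "\<And>z. z \<in> U \<Longrightarrow> (k has_field_derivative k' z) (at z)"
      "\<And>z. z \<in> U \<Longrightarrow> (k' has_field_derivative P z * k z) (at z)"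
    and l: "\<And>z. z \<in> U \<Longrightarrow> (l has_field_derivative l' z) (at z)"
      "\<And>z. z \<in> U \<Longrightarrow> (l' has_field_derivative P z * l z) (at z)"
    and W: "\<And>z. z \<in> U \<Longrightarrow> l' z * k z - k' z * l z \<noteq> 0"
    and "z \<in> U"
  shows "d z = 0"
proof -
  \<comment> \<open>A Wronskian in \<open>z\<close> followed by one in the conjugate variable: both Wirtinger derivatives vanish.\<close>
  define T where "T h h' m m' z = (d z * h' z - d1 z * h z) * cnj (m' z) - (d2 z * h' z - d12 z * h z) * cnj (m z)"
    for h h' m m' :: "complex \<Rightarrow> complex" and z
  have T0: "T h h' m m' z = 0"
    if "\<And>z. z \<in> U \<Longrightarrow> (h has_field_derivative h' z) (at z)"
      "\<And>z. z \<in> U \<Longrightarrow> (h' has_field_derivative P z * h z) (at z)"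
      "\<And>z. z \<in> U \<Longrightarrow> (m has_field_derivative m' z) (at z)"
      "\<And>z. z \<in> U \<Longrightarrow> (m' has_field_derivative P z * m z) (at z)" for h h' m m'
  proof -
    have "has_wirtinger (T h h' m m') 0 0 z" if "z \<in> U" for z
    proof -
      note f = has_wirtinger_field[OF \<open>\<And>z. z \<in> U \<Longrightarrow> (h has_field_derivative h' z) (at z)\<close>[OF that]]
        has_wirtinger_field[OF \<open>\<And>z. z \<in> U \<Longrightarrow> (h' has_field_derivative P z * h z) (at z)\<close>[OF that]]
        has_wirtinger_field[OF \<open>\<And>z. z \<in> U \<Longrightarrow> (m has_field_derivative m' z) (at z)\<close>[OF that]]
        has_wirtinger_field[OF \<open>\<And>z. z \<in> U \<Longrightarrow> (m' has_field_derivative P z * m z) (at z)\<close>[OF that]]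
      show ?thesis
        unfolding T_def[abs_def]
        by (rule has_wirtinger_eq, (rule has_wirtinger_diff has_wirtinger_mult has_wirtinger_cnj f d that)+)
           (simp_all add: algebra_simps)
    qed
    then have "T h h' m m' z = T h h' m m' p"
      by (intro has_derivative_zero_unique_connected[OF U(1,2)]) (use \<open>z \<in> U\<close> U in \<open>auto simp: has_wirtinger_def\<close>)
    then show ?thesis using zero by (simp add: T_def)
  qed
  define W where "W = l' z * k z - k' z * l z"
  have "W \<noteq> 0" using W[OF \<open>z \<in> U\<close>] by (simp add: W_def)
  \<comment> \<open>Cramer's rule in each variable: the first elimination removes \<open>d1\<close>
    and \<open>d12\<close>, the second removes \<open>d2\<close>.\<close>
  have "d z * W * cnj W =
      (T l l' l l' z * k z - T k k' l l' z * l z) * cnj (k z) - (T l l' k k' z * k z - T k k' k k' z * l z) * cnj (l z)"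
    by (simp add: T_def W_def algebra_simps)
  also have "\<dots> = 0"
    by (simp add: T0 k l)
  finally show ?thesis using \<open>W \<noteq> 0\<close> by simp
qed


text \<open>Here \<open>q\<close> is the logarithmic derivative of \<open>\<nu>\<close> and
  \<open>r\<close> its derivative. Solutions \<open>k\<close>, \<open>l\<close> are chosen so that
  the Hermitian form has the same jet at \<open>p\<close> as \<open>1 / sqrt \<nu>\<close>; the
  uniqueness lemma makes the two agree.\<close>

lemma hermitian_form_of_liouville_solution:
  assumes "open D" "p \<in> D" and pos: "\<And>z. z \<in> D \<Longrightarrow> \<nu> z > 0"
    and N: "\<And>z. z \<in> D \<Longrightarrow> has_wirtinger (\<lambda>z. of_real (\<nu> z)) (q z * of_real (\<nu> z)) (cnj (q z) * of_real (\<nu> z)) z"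
    and q: "\<And>z. z \<in> D \<Longrightarrow> has_wirtinger q (r z) (of_real (\<nu> z) / 2) z"
    and r: "\<And>z. z \<in> D \<Longrightarrow> has_wirtinger r (r1 z) (q z * of_real (\<nu> z) / 2) z"
  obtains \<rho> k l where "\<rho> > 0" "ball p \<rho> \<subseteq> D" "k holomorphic_on ball p \<rho>" "l holomorphic_on ball p \<rho>"
    "\<And>z. z \<in> ball p \<rho> \<Longrightarrow> deriv l z * k z - deriv k z * l z = 1 / 2"
    "\<And>z. z \<in> ball p \<rho> \<Longrightarrow> 1 / sqrt (\<nu> z) = (norm (k z))\<^sup>2 - (norm (l z))\<^sup>2"
proof -
  define P where "P z = (- 1 / 2) * (r z - (1 / 2) * (q z * q z))" for z
  have "P holomorphic_on D"
    unfolding holomorphic_on_open[OF \<open>open D\<close>]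
  proof (intro ballI exI)
    fix z assume z: "z \<in> D"
    \<comment> \<open>The conjugate derivatives \<open>q * \<nu> / 2\<close> of \<open>r\<close> and
      of \<open>q * q / 2\<close> cancel.\<close>
    have "has_wirtinger (\<lambda>z. (- 1 / 2) * (r z - (1 / 2) * (q z * q z))) ((- 1 / 2) * (r1 z - (1 / 2) * (r z * q z + q z * r z))) 0 z"
      by (rule has_wirtinger_eq, (rule has_wirtinger_cmult has_wirtinger_diff has_wirtinger_mult q r z)+)
         (simp_all add: algebra_simps)
    then show "(P has_field_derivative ((- 1 / 2) * (r1 z - (1 / 2) * (r z * q z + q z * r z)))) (at z)"
      unfolding P_def[abs_def] by (rule has_wirtinger_imp_field)
  qed
  moreover obtain R where R: "R > 0" "ball p R \<subseteq> D"
    using assms openE by blast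
  ultimately have P: "P holomorphic_on ball p R"
    using holomorphic_on_subset by blast

  \<comment> \<open>\<open>g1\<close>, \<open>g2\<close> and \<open>g12\<close> are the
    \<open>z\<close>-derivative, the conjugate derivative and the mixed derivative of
    \<open>G\<close>.\<close>
  define G where "G z = complex_of_real (1 / sqrt (\<nu> z))" for z
  define g1 where "g1 z = (- 1 / 2) * (q z * G z)" for z
  define g2 where "g2 z = (- 1 / 2) * (cnj (q z) * G z)" for z
  define g12 where "g12 z = (1 / 4) * ((q z * cnj (q z) - of_real (\<nu> z)) * G z)" for z
  have G: "has_wirtinger G (g1 z) (g2 z) z" if z: "z \<in> D" for z
  proof -
    \<comment> \<open>The complex square root is used because the chain rule asks for a
      complex-differentiable outer function; on positive reals it is the real root.\<close>
    define c where "c = csqrt (of_real (\<nu> z))"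
    have c: "of_real (\<nu> z) = c * c" "c \<noteq> 0"
      using power2_csqrt[of "of_real (\<nu> z)"] pos[OF z] by (auto simp only: c_def power2_eq_square csqrt_eq_0) simp
    have Gs: "G w = inverse (csqrt (of_real (\<nu> w)))" if "w \<in> D" for w
      using pos[OF that] by (simp add: G_def inverse_eq_divide)
    have "(csqrt has_field_derivative inverse (2 * c)) (at (of_real (\<nu> z)))"
      unfolding c_def by (rule has_field_derivative_csqrt) (use pos[OF z] in auto)
    from has_wirtinger_inverse[OF has_wirtinger_compose_field[OF N[OF z] this]]
    have "has_wirtinger (\<lambda>w. inverse (csqrt (of_real (\<nu> w)))) (- (inverse (2 * c) * (q z * (c * c))) / c\<^sup>2)
        (- (inverse (2 * c) * (cnj (q z) * (c * c))) / c\<^sup>2) z"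
      by (fold c_def) (use c in \<open>simp only: simp_thms\<close>)
    then have "has_wirtinger (\<lambda>w. inverse (csqrt (of_real (\<nu> w)))) (g1 z) (g2 z) z"
      by (rule has_wirtinger_eq; unfold g1_def g2_def Gs[OF z]; fold c_def)
         (use c(2) in \<open>simp_all add: power2_eq_square divide_simps\<close>)
    then show ?thesis
      by (rule has_wirtinger_transform[OF _ \<open>open D\<close> z]) (simp add: Gs)
  qed
  have cG: "cnj (G z) = G z" for z by (simp add: G_def)
  have g1: "has_wirtinger g1 (P z * G z) (g12 z) z" if z: "z \<in> D" for z
    unfolding g1_def[abs_def]
    by (rule has_wirtinger_eq, (rule has_wirtinger_cmult has_wirtinger_mult q G z)+)
       (simp_all add: g1_def g2_def g12_def P_def field_simps)
  have g2: "has_wirtinger g2 (g12 z) (cnj (P z) * G z) z" if z: "z \<in> D" for z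
    unfolding g2_def[abs_def]
    by (rule has_wirtinger_eq, (rule has_wirtinger_cmult has_wirtinger_mult has_wirtinger_cnj q G z)+)
       (simp_all add: g1_def g2_def g12_def P_def field_simps)
  have g12: "has_wirtinger g12 (P z * g2 z) (cnj (P z) * g1 z) z" if z: "z \<in> D" for z
    unfolding g12_def[abs_def]
    by (rule has_wirtinger_eq, (rule has_wirtinger_cmult has_wirtinger_mult has_wirtinger_diff has_wirtinger_cnj q G N z)+)
       (simp_all add: g1_def g2_def g12_def P_def field_simps)

  \<comment> \<open>The initial values below come from completing the square in the Hermitian form whose
    2-jet at \<open>p\<close> is that of \<open>G\<close>.\<close>
  define s where "s = complex_of_real (sqrt (1 / sqrt (\<nu> p)))"
  have Gp: "G p \<noteq> 0" "G p * G p * of_real (\<nu> p) = 1"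
    using pos[OF \<open>p \<in> D\<close>] by (simp_all add: G_def flip: of_real_mult)
  have s: "s * s = G p" "s \<noteq> 0" "cnj s = s"
    using pos[OF \<open>p \<in> D\<close>] unfolding s_def G_def of_real_mult[symmetric] by (simp_all add: real_sqrt_divide)
  obtain k \<rho>k where k: "0 < \<rho>k" "\<rho>k \<le> R" "k holomorphic_on ball p \<rho>k" "k p = s" "deriv k p = g1 p / s"
    "\<And>z. z \<in> ball p \<rho>k \<Longrightarrow> deriv (deriv k) z = P z * k z"
    using holomorphic_linear_ODE2[OF P R(1)] by blast
  obtain l \<rho>l where l: "0 < \<rho>l" "\<rho>l \<le> R" "l holomorphic_on ball p \<rho>l" "l p = 0" "deriv l p = 1 / (2 * s)"
    "\<And>z. z \<in> ball p \<rho>l \<Longrightarrow> deriv (deriv l) z = P z * l z"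
    using holomorphic_linear_ODE2[OF P R(1)] by blast
  define \<rho> where "\<rho> = min \<rho>k \<rho>l"
  define U where "U = ball p \<rho>"
  have \<rho>: "\<rho> > 0" and Uk: "U \<subseteq> ball p \<rho>k" and Ul: "U \<subseteq> ball p \<rho>l" and UD: "U \<subseteq> D"
    using k(1,2) l(1,2) R by (auto simp: \<rho>_def U_def)
  have U: "open U" "connected U" "p \<in> U"
    using \<rho> by (auto simp: U_def)
  have hk: "k holomorphic_on U" and hl: "l holomorphic_on U"
    using k(3) l(3) Uk Ul holomorphic_on_subset by blast+
  have dk: "(k has_field_derivative deriv k z) (at z)" and dl: "(l has_field_derivative deriv l z) (at z)"
    if "z \<in> U" for z
    using hk hl that U(1) by (auto intro: holomorphic_derivI)
  have ddk: "(deriv k has_field_derivative P z * k z) (at z)" and ddl: "(deriv l has_field_derivative P z * l z) (at z)"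
    if "z \<in> U" for z
    using holomorphic_derivI[OF holomorphic_deriv[OF hk U(1)] U(1) that] holomorphic_derivI[OF holomorphic_deriv[OF hl U(1)] U(1) that]
      k(6)[of z] l(6)[of z] that Uk Ul by auto
  \<comment> \<open>The derivative is \<open>P l k - P k l = 0\<close>, and the value at
    \<open>p\<close> is \<open>1 / (2 * s) * s\<close>.\<close>
  have wronskian: "deriv l z * k z - deriv k z * l z = 1 / 2" if "z \<in> U" for z
  proof -
    have "((\<lambda>z. deriv l z * k z - deriv k z * l z) has_derivative (\<lambda>h. 0)) (at w)" if "w \<in> U" for w
    proof -
      have "((\<lambda>z. deriv l z * k z - deriv k z * l z) has_field_derivative 0) (at w)"
        using DERIV_diff[OF DERIV_mult[OF ddl[OF that] dk[OF that]] DERIV_mult[OF ddk[OF that] dl[OF that]]]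
        by (simp add: algebra_simps)
      then show ?thesis by (simp add: has_field_derivative_def lambda_zero)
    qed
    then have "deriv l z * k z - deriv k z * l z = deriv l p * k p - deriv k p * l p"
      by (rule has_derivative_zero_unique_connected[OF U(1,2)]) (use that U in auto)
    also have "\<dots> = 1 / 2" using k(4) l(4,5) s by simp
    finally show ?thesis .
  qed
  \<comment> \<open>The jet of \<open>G\<close> minus that of the Hermitian form; by linearity it
    satisfies the same system.\<close>
  define d where "d z = G z - k z * cnj (k z) + l z * cnj (l z)" for z
  define d1 where "d1 z = g1 z - deriv k z * cnj (k z) + deriv l z * cnj (l z)" for z
  define d2 where "d2 z = g2 z - k z * cnj (deriv k z) + l z * cnj (deriv l z)" for z
  define d12 where "d12 z = g12 z - deriv k z * cnj (deriv k z) + deriv l z * cnj (deriv l z)" for z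
  note rules = has_wirtinger_add has_wirtinger_diff has_wirtinger_mult has_wirtinger_cnj
    has_wirtinger_field[OF dk] has_wirtinger_field[OF dl] has_wirtinger_field[OF ddk] has_wirtinger_field[OF ddl]
    G g1 g2 g12
  have "d z = 0" if "z \<in> U" for z
  proof (rule has_wirtinger_zero_system[OF U, of d d1 d2 P d12 k "deriv k" l "deriv l"])
    show "has_wirtinger d (d1 z) (d2 z) z" if z: "z \<in> U" for z
      unfolding d_def[abs_def]
      by (rule has_wirtinger_eq, (rule rules z subsetD[OF UD z])+) (simp_all add: d1_def d2_def)
    show "has_wirtinger d1 (P z * d z) (d12 z) z" if z: "z \<in> U" for z
      unfolding d1_def[abs_def]
      by (rule has_wirtinger_eq, (rule rules z subsetD[OF UD z])+) (simp_all add: d_def d12_def algebra_simps)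
    show "has_wirtinger d2 (d12 z) (cnj (P z) * d z) z" if z: "z \<in> U" for z
      unfolding d2_def[abs_def]
      by (rule has_wirtinger_eq, (rule rules z subsetD[OF UD z])+) (simp_all add: d_def d12_def algebra_simps)
    show "has_wirtinger d12 (P z * d2 z) (cnj (P z) * d1 z) z" if z: "z \<in> U" for z
      unfolding d12_def[abs_def]
      by (rule has_wirtinger_eq, (rule rules z subsetD[OF UD z])+) (simp_all add: d1_def d2_def algebra_simps)
    \<comment> \<open>As \<open>l p = 0\<close>, \<open>l\<close> enters only the mixed entry;
      \<open>k\<close> alone matches \<open>G\<close>, \<open>g1\<close> and \<open>g2\<close>, with
      \<open>g2 p\<close> conjugate to \<open>g1 p\<close> and \<open>s\<close> real.\<close>
    show "d p = 0" "d1 p = 0"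
      using s k(4,5) l(4,5) by (simp_all add: d_def d1_def)
    show "d2 p = 0"
      using s k(4,5) l(4,5) by (simp add: d2_def g1_def g2_def cG)
    \<comment> \<open>The determinant \<open>G p * g12 p - g1 p * g2 p\<close> is -1/4 because
      \<open>G p * G p * \<nu> p = 1\<close>; the value \<open>1 / (2 * s)\<close> of
      \<open>deriv l p\<close> compensates exactly this.\<close>
    have "g12 p - g1 p / s * (g2 p / s) + 1 / (2 * s) * (1 / (2 * s)) = g12 p - g1 p * g2 p / G p + 1 / (4 * G p)"
      using s by (simp add: divide_simps)
    also have "\<dots> = (1 - G p * G p * of_real (\<nu> p)) / (4 * G p)"
      using Gp(1) by (simp add: g1_def g2_def g12_def field_simps)
    finally show "d12 p = 0"
      using Gp s k(4,5) l(4,5) by (simp add: d12_def g1_def g2_def cG)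
    show "deriv l z * k z - deriv k z * l z \<noteq> 0" if "z \<in> U" for z
      by (simp only: wronskian[OF that]) simp
  qed (fact dk dl ddk ddl that)+
  then have "G z = k z * cnj (k z) - l z * cnj (l z)" if "z \<in> U" for z
    using that by (simp add: d_def algebra_simps)
  then have "complex_of_real (1 / sqrt (\<nu> z)) = of_real ((norm (k z))\<^sup>2 - (norm (l z))\<^sup>2)" if "z \<in> U" for z
    using that by (simp only: G_def of_real_diff complex_norm_square)
  then have "1 / sqrt (\<nu> z) = (norm (k z))\<^sup>2 - (norm (l z))\<^sup>2" if "z \<in> U" for z
    using that of_real_eq_iff by blast
  then show ?thesis
    using that[of \<rho> k l] \<rho> UD hk hl wronskian by (simp add: U_def)
qed

text \<open>Rewrites the equation for \<open>q = \<nu>\<^sub>z / \<nu>\<close> and differentiates it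
  once more. The conjugate derivative of \<open>r\<close> involves third derivatives of
  \<open>\<nu>\<close>, hence \<open>Ck_on 3\<close>.\<close>

lemma liouville_wirtinger:
  fixes \<nu> :: "complex \<Rightarrow> real"
  assumes D: "open D" and C3: "Ck_on 3 \<nu> D" and pos: "\<And>z. z \<in> D \<Longrightarrow> \<nu> z > 0"
    and pde: "\<And>z. z \<in> D \<Longrightarrow> laplacian (\<lambda>\<zeta>. ln (\<nu> \<zeta>)) z = 2 * \<nu> z"
  obtains q r r1 where
    "\<And>z. z \<in> D \<Longrightarrow> has_wirtinger (\<lambda>z. of_real (\<nu> z)) (q z * of_real (\<nu> z)) (cnj (q z) * of_real (\<nu> z)) z"
    "\<And>z. z \<in> D \<Longrightarrow> has_wirtinger q (r z) (of_real (\<nu> z) / 2) z"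
    "\<And>z. z \<in> D \<Longrightarrow> has_wirtinger r (r1 z) (q z * of_real (\<nu> z) / 2) z"
proof -
  define X Y where "X = pdx \<nu>" and "Y = pdy \<nu>"
  have C2: "Ck_on 2 \<nu> D" "Ck_on 2 X D" "Ck_on 2 Y D"
    using C3 by (auto simp: numeral_3_eq_3 numeral_2_eq_2 X_def Y_def intro: differentiable_imp_continuous_on)
  have diff: "\<nu> differentiable_on D" "X differentiable_on D" "Y differentiable_on D"
    "pdx X differentiable_on D" "pdy X differentiable_on D" "pdx Y differentiable_on D" "pdy Y differentiable_on D"
    using C2 by (auto simp: numeral_2_eq_2)
  have sym: "pdy X z = pdx Y z" "pdy (pdx X) z = pdx (pdy X) z" "pdy (pdx Y) z = pdx (pdy Y) z" if "z \<in> D" for z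
    using pdy_pdx_commute[OF D C2(1) that] pdy_pdx_commute[OF D C2(2) that] pdy_pdx_commute[OF D C2(3) that]
    by (simp_all add: X_def Y_def)
  have sym': "pdy (pdy X) z = pdy (pdx Y) z" if "z \<in> D" for z
    using pd_cong(2)[OF diff(5) D that sym(1)] .
  define N where "N z = complex_of_real (\<nu> z)" for z
  have N0: "N z \<noteq> 0" if "z \<in> D" for z using pos[OF that] by (simp add: N_def)
  \<comment> \<open>The digits record derivatives of \<open>N\<close>: 1 in \<open>z\<close>, 2 in
    the conjugate. Thus \<open>N12\<close> is a quarter of the Laplacian of
    \<open>\<nu>\<close>.\<close>
  define N1 where "N1 z = (1 / 2) * (of_real (X z) - \<i> * of_real (Y z))" for z
  define N11 where "N11 z = (1 / 4) * (of_real (pdx X z) - of_real (pdy Y z) - 2 * \<i> * of_real (pdy X z))" for z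
  define N12 where "N12 z = (1 / 4) * (of_real (pdx X z) + complex_of_real (pdy Y z))" for z
  define N112 where "N112 z = (1 / 8) * (of_real (pdx (pdx X) z) + of_real (pdx (pdy Y) z)
    - \<i> * (of_real (pdy (pdx X) z) + of_real (pdy (pdy Y) z)))" for z
  define N111 where "N111 z = (1 / 8) * (of_real (pdx (pdx X) z) - of_real (pdx (pdy Y) z) - 2 * of_real (pdy (pdy X) z)
    - \<i> * (of_real (pdy (pdx X) z) - of_real (pdy (pdy Y) z) + 2 * of_real (pdx (pdy X) z)))" for z
  define q where "q z = N1 z * inverse (N z)" for z
  \<comment> \<open>The quotient rule for the \<open>z\<close>-derivative of
    \<open>N1 / N\<close>.\<close>
  define r where "r z = N11 z * inverse (N z) - q z * q z" for z
  have N1q: "N1 z = q z * N z" if "z \<in> D" for z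
    using N0[OF that] by (simp add: q_def)
  have N11r: "N11 z = (r z + q z * q z) * N z" if "z \<in> D" for z
    using N0[OF that] by (simp add: r_def)
  note of_real = has_wirtinger_of_real[OF _ D]
  note rules = has_wirtinger_cmult has_wirtinger_add has_wirtinger_diff has_wirtinger_mult has_wirtinger_cnj has_wirtinger_inverse
  have wN: "has_wirtinger N (q z * N z) (cnj (q z) * N z) z" if "z \<in> D" for z
  proof -
    have "q z * N z = N1 z" "cnj (q z) * N z = cnj (N1 z)"
      using N1q[OF that] by (simp_all add: N_def)
    then show ?thesis
      unfolding N_def[abs_def]
      by (intro has_wirtinger_eq[OF of_real[OF diff(1) that]])
         (auto simp: N_def N1_def X_def Y_def complex_eq_iff)
  qed
  have wN1: "has_wirtinger N1 (N11 z) (N12 z) z" if "z \<in> D" for z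
    unfolding N1_def[abs_def]
    by (rule has_wirtinger_eq, (rule rules of_real diff that)+)
       (auto simp: N11_def N12_def sym(1)[OF that] complex_eq_iff)
  \<comment> \<open>This is the differential equation. Comparing \<open>N11\<close> with \<open>N12\<close> by symmetry of the third
    derivatives then gives the conjugate derivative of \<open>r\<close>.\<close>
  have N12: "N12 z = N z * N z / 2 + N z * q z * cnj (q z)" if "z \<in> D" for z
  proof -
    have "pdx X z + pdy Y z = 2 * (\<nu> z)\<^sup>2 + ((X z)\<^sup>2 + (Y z)\<^sup>2) / \<nu> z"
    proof -
      have "pdx X z + pdy Y z = (pdx X z + pdy Y z) / \<nu> z * \<nu> z"
        using pos[OF that] by simp
      also have "(pdx X z + pdy Y z) / \<nu> z = 2 * \<nu> z + ((X z)\<^sup>2 + (Y z)\<^sup>2) / (\<nu> z)\<^sup>2"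
        using pde[OF that] laplacian_ln[OF D C2(1) pos that] by (simp add: X_def Y_def)
      also have "\<dots> * \<nu> z = 2 * (\<nu> z)\<^sup>2 + ((X z)\<^sup>2 + (Y z)\<^sup>2) / \<nu> z"
        using pos[OF that] by (simp add: field_simps power2_eq_square)
      finally show ?thesis .
    qed
    then have "N12 z = (1 / 4) * of_real (2 * (\<nu> z)\<^sup>2 + ((X z)\<^sup>2 + (Y z)\<^sup>2) / \<nu> z)"
      unfolding N12_def of_real_add[symmetric] by (rule arg_cong)
    also have "\<dots> = N z * N z / 2 + N1 z * cnj (N1 z) / N z"
      using pos[OF that] by (simp add: N_def N1_def complex_eq_iff power2_eq_square field_simps)
    finally show ?thesis
      using N0[OF that] N1q[OF that] by (simp add: N_def)
  qed
  \<comment> \<open>The conjugate derivative is \<open>N12 / N - q * cnj q\<close>, which the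
    equation reduces to \<open>N / 2\<close>.\<close>
  have wq: "has_wirtinger q (r z) (N z / 2) z" if "z \<in> D" for z
    unfolding q_def[abs_def]
    by (rule has_wirtinger_eq, (rule rules wN1 wN N0 that)+)
       (use N0[OF that] in \<open>simp_all add: N12[OF that] N11r[OF that] N1q[OF that] power2_eq_square field_simps\<close>)
  have wN11: "has_wirtinger N11 (N111 z) (N112 z) z" if "z \<in> D" for z
    unfolding N11_def[abs_def]
    by (rule has_wirtinger_eq, (rule rules of_real diff that)+)
       (auto simp: N111_def N112_def sym[OF that] sym'[OF that] complex_eq_iff)
  have "has_wirtinger N12 (N112 z) (cnj (N112 z)) z" if "z \<in> D" for z
    unfolding N12_def[abs_def]
    by (rule has_wirtinger_eq, (rule rules of_real diff that)+)
       (auto simp: N112_def complex_eq_iff)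
  \<comment> \<open>A second computation of the same derivatives, now from the equation; uniqueness
    then expresses \<open>N112\<close> without third partials.\<close>
  moreover have "has_wirtinger N12 (3 / 2 * q z * N z * N z + cnj (q z) * N11 z)
      (3 / 2 * cnj (q z) * N z * N z + q z * cnj (N11 z)) z" if "z \<in> D" for z
  proof -
    have cN: "cnj (N w) = N w" for w by (simp add: N_def)
    have "has_wirtinger (\<lambda>z. (1 / 2) * (N z * N z) + N z * (q z * cnj (q z)))
      (3 / 2 * q z * N z * N z + cnj (q z) * N11 z) (3 / 2 * cnj (q z) * N z * N z + q z * cnj (N11 z)) z"
      by (rule has_wirtinger_eq, (rule rules wq wN that)+)
         (simp_all add: N11r[OF that] cN field_simps)
    then show ?thesis
      by (rule has_wirtinger_transform[OF _ D that]) (simp add: N12 mult.assoc)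
  qed
  ultimately have N112: "N112 z = 3 / 2 * q z * N z * N z + cnj (q z) * N11 z" if "z \<in> D" for z
    using has_wirtinger_unique(1) that by blast
  \<comment> \<open>In the conjugate derivative the \<open>N11\<close> terms cancel, leaving
    \<open>3 / 2 * q * N - q * N\<close>. The \<open>z\<close>-derivative is only asserted to
    exist.\<close>
  have "\<exists>c. has_wirtinger r c (q z * N z / 2) z" if "z \<in> D" for z
    unfolding r_def[abs_def]
    by (rule exI, rule has_wirtinger_eq, (rule rules wN11 wq wN N0 that refl)+)
       (use N0[OF that] in \<open>simp_all add: N112[OF that] N11r[OF that] power2_eq_square field_simps\<close>)
  then obtain r1 where "\<And>z. z \<in> D \<Longrightarrow> has_wirtinger r (r1 z) (q z * N z / 2) z"
    by metis
  then show ?thesis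
    using that[of q r r1] wN wq by (simp add: N_def[abs_def])
qed

section \<open>The local formula from a quotient of two solutions\<close>

theorem corollary3p2:
  fixes \<nu> :: "complex \<Rightarrow> real" and D :: "complex set"
  assumes "open D" and "connected D"
    and "smooth_on \<nu> D"
    and "\<And>z. z \<in> D \<Longrightarrow> \<nu> z > 0"
    and "\<And>z. z \<in> D \<Longrightarrow> pdx \<nu> z * pdy \<nu> z \<noteq> 0"
    and "\<And>z. z \<in> D \<Longrightarrow> laplacian (\<lambda>\<zeta>. ln (\<nu> \<zeta>)) z - 2 * \<nu> z = 0"
  shows "\<forall>p\<in>D. \<exists>U w u v. open U \<and> p \<in> U \<and> U \<subseteq> D \<and> w holomorphic_on U \<and>
           u = (\<lambda>z. Re (w z)) \<and> v = (\<lambda>z. Im (w z)) \<and>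
           (\<forall>z\<in>U. (u z)\<^sup>2 + (v z)\<^sup>2 - 1 \<noteq> 0 \<and>
             \<nu> z = 4 * ((pdx u z)\<^sup>2 + (pdy u z)\<^sup>2) / ((u z)\<^sup>2 + (v z)\<^sup>2 - 1)\<^sup>2)"
proof
  fix p assume p: "p \<in> D"
  have C3: "Ck_on 3 \<nu> D" using assms(3) by (simp add: smooth_on_def)
  have pde: "laplacian (\<lambda>\<zeta>. ln (\<nu> \<zeta>)) z = 2 * \<nu> z" if "z \<in> D" for z
    using assms(6)[OF that] by simp
  obtain q r r1 where wirtinger:
    "\<And>z. z \<in> D \<Longrightarrow> has_wirtinger (\<lambda>z. of_real (\<nu> z)) (q z * of_real (\<nu> z)) (cnj (q z) * of_real (\<nu> z)) z"
    "\<And>z. z \<in> D \<Longrightarrow> has_wirtinger q (r z) (of_real (\<nu> z) / 2) z"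
    "\<And>z. z \<in> D \<Longrightarrow> has_wirtinger r (r1 z) (q z * of_real (\<nu> z) / 2) z"
    by (rule liouville_wirtinger[OF assms(1) C3 assms(4) pde]) (assumption | rule that)+
  obtain \<rho> k l where \<rho>: "\<rho> > 0" "ball p \<rho> \<subseteq> D"
    and hol: "k holomorphic_on ball p \<rho>" "l holomorphic_on ball p \<rho>"
    and W: "\<And>z. z \<in> ball p \<rho> \<Longrightarrow> deriv l z * k z - deriv k z * l z = 1 / 2"
    and form: "\<And>z. z \<in> ball p \<rho> \<Longrightarrow> 1 / sqrt (\<nu> z) = (norm (k z))\<^sup>2 - (norm (l z))\<^sup>2"
    by (rule hermitian_form_of_liouville_solution[OF assms(1) p assms(4) wirtinger]) (assumption | rule that)+
  define w where "w z = l z / k z" for z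
  \<comment> \<open>Positivity of \<open>1 / sqrt \<nu>\<close> keeps \<open>k\<close> free of zeros
    and puts \<open>w\<close> in the open unit disc.\<close>
  have less: "(norm (l z))\<^sup>2 < (norm (k z))\<^sup>2" if "z \<in> ball p \<rho>" for z
    using form[OF that] assms(4)[of z] \<rho>(2) that
    by (smt (verit) real_sqrt_gt_zero subset_iff zero_less_divide_1_iff)
  have k0: "k z \<noteq> 0" if "z \<in> ball p \<rho>" for z
    using less[OF that] by auto
  have "(Re (w z))\<^sup>2 + (Im (w z))\<^sup>2 - 1 \<noteq> 0 \<and>
      \<nu> z = 4 * ((pdx (\<lambda>z. Re (w z)) z)\<^sup>2 + (pdy (\<lambda>z. Re (w z)) z)\<^sup>2) / ((Re (w z))\<^sup>2 + (Im (w z))\<^sup>2 - 1)\<^sup>2"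
    if z: "z \<in> ball p \<rho>" for z
  proof -
    \<comment> \<open>In these terms \<open>|w'|\<^sup>2 = 1 / (4 * a\<^sup>2)\<close> and
      \<open>|w|\<^sup>2 = b / a\<close>, so both sides become
      \<open>1 / (a - b)\<^sup>2\<close>.\<close>
    define a b where "a = (norm (k z))\<^sup>2" and "b = (norm (l z))\<^sup>2"
    have ab: "b < a" "a > 0" using less[OF z] k0[OF z] by (simp_all add: a_def b_def)
    have "(w has_field_derivative (deriv l z * k z - l z * deriv k z) / (k z * k z)) (at z)"
      unfolding w_def[abs_def] using hol z k0[OF z] by (intro DERIV_divide holomorphic_derivI) auto
    then have "(w has_field_derivative (1 / 2) / (k z * k z)) (at z)"
      using W[OF z] by (simp add: mult.commute[of "l z"])
    from gradient_Re_holomorphic[OF this]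
    have grad: "(pdx (\<lambda>z. Re (w z)) z)\<^sup>2 + (pdy (\<lambda>z. Re (w z)) z)\<^sup>2 = 1 / (4 * a\<^sup>2)"
      by (simp add: a_def norm_divide norm_mult power2_eq_square)
    have w: "(Re (w z))\<^sup>2 + (Im (w z))\<^sup>2 = b / a"
      by (simp add: a_def b_def w_def norm_divide power_divide flip: cmod_power2)
    have "\<nu> z > 0" using assms(4) \<rho>(2) z by auto
    then have "\<nu> z = 1 / (1 / sqrt (\<nu> z))\<^sup>2" by (simp add: power_divide)
    also have "\<dots> = 1 / (a - b)\<^sup>2"
      unfolding form[OF z] a_def b_def ..
    also have "\<dots> = 4 * (1 / (4 * a\<^sup>2)) / (b / a - 1)\<^sup>2"
    proof -
      have "a\<^sup>2 * (b / a - 1)\<^sup>2 = (a - b)\<^sup>2"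
        using ab by (simp add: power2_commute[of a] field_simps flip: power_mult_distrib)
      then show ?thesis by simp
    qed
    finally show ?thesis
      unfolding grad w using ab by simp
  qed
  moreover have "w holomorphic_on ball p \<rho>"
    unfolding w_def[abs_def] using hol k0 by (intro holomorphic_on_divide) auto
  ultimately show "\<exists>U w u v. open U \<and> p \<in> U \<and> U \<subseteq> D \<and> w holomorphic_on U \<and>
           u = (\<lambda>z. Re (w z)) \<and> v = (\<lambda>z. Im (w z)) \<and>
           (\<forall>z\<in>U. (u z)\<^sup>2 + (v z)\<^sup>2 - 1 \<noteq> 0 \<and>
             \<nu> z = 4 * ((pdx u z)\<^sup>2 + (pdy u z)\<^sup>2) / ((u z)\<^sup>2 + (v z)\<^sup>2 - 1)\<^sup>2)"
    using \<rho> by (intro exI[of _ "ball p \<rho>"] exI[of _ w] exI[of _ "\<lambda>z. Re (w z)"] exI[of _ "\<lambda>z. Im (w z)"]) auto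
qed

end
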